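(* $U_3(n,3)\ge\Omega(n^{5/3})$; that is, there is a constant $c>0$ such that $U_3(n,3)\ge c\,n^{5/3}$ for all sufficiently large $n$.
   Context: A family $\mathcal F$ of subsets of $[n]=\{1,\dots,n\}$ is $e$-union-free if for any two distinct subfamilies $\mathcal A,\mathcal B\subseteq\mathcal F$ with $0<|\mathcal A|,|\mathcal B|\le e$ one has $\bigcup_{A\in\mathcal A}A\ne\bigcup_{B\in\mathcal B}B$. $U_r(n,e)$ is the maximum size of an $e$-union-free family of $r$-element subsets of $[n]$; here $r=e=3$. *)

theory Defs
  imports Complex_Main
begin

definition union_free :: "nat \<Rightarrow> 'a set set \<Rightarrow> bool" where
  "union_free e F \<longleftrightarrow>
     (\<forall>A B. A \<subseteq> F \<and> B \<subseteq> F \<and> A \<noteq> B \<and>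
            0 < card A \<and> card A \<le> e \<and> 0 < card B \<and> card B \<le> e \<longrightarrow> \<Union>A \<noteq> \<Union>B)"

definition union_free_families :: "nat \<Rightarrow> nat \<Rightarrow> nat \<Rightarrow> nat set set set" where
  "union_free_families r n e =
     {F. (\<forall>A\<in>F. A \<subseteq> {1..n} \<and> card A = r) \<and> union_free e F}"

definition U :: "nat \<Rightarrow> nat \<Rightarrow> nat \<Rightarrow> nat" where
  "U r n e = Max (card ` union_free_families r n e)"

text \<open>The maximum is taken over a finite nonempty set, so \<open>U\<close> is attained and is an upper bound.\<close>

lemma finite_union_free_families: "finite (union_free_families r n e)"
proof (rule finite_subset)
  show "union_free_families r n e \<subseteq> Pow (Pow {1..n})"
    by (auto simp: union_free_families_def)
qed simp

lemma empty_in_union_free_families: "{} \<in> union_free_families r n e"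
  by (auto simp: union_free_families_def union_free_def)

lemma U_attained: "\<exists>F \<in> union_free_families r n e. card F = U r n e"
proof -
  have "U r n e \<in> card ` union_free_families r n e"
    unfolding U_def using empty_in_union_free_families[of r n e]
    by (intro Max_in) (auto simp: finite_union_free_families simp del: empty_iff)
  then show ?thesis by auto
qed

lemma card_le_U: "F \<in> union_free_families r n e \<Longrightarrow> card F \<le> U r n e"
  unfolding U_def by (intro Max_ge) (auto simp: finite_union_free_families)

end

theory Submission
  imports Defs
begin

text \<open>
  The lower bound comes from the deletion method. Keep each of the \<open>n choose 3\<close> triples independently
  with probability \<open>p = c n\<^sup>-\<^sup>4\<^sup>/\<^sup>3\<close>, so that about \<open>n\<^sup>5\<^sup>/\<^sup>3\<close> triples are expected to survive. A set of
  \<open>s\<close> triples spanning \<open>v\<close> points has about \<open>n\<^sup>v\<close> positions, each surviving with probability \<open>p\<^sup>s\<close>, and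
  \<open>n\<^sup>v p\<^sup>s\<close> is of order at most \<open>n\<^sup>5\<^sup>/\<^sup>3\<close> exactly when \<open>3v \<le> 4s + 5\<close>. Since \<open>s \<ge> 2\<close>, the implied
  constant carries a factor \<open>c\<^sup>2\<close>, against \<open>c\<close> for the expected number of triples. For small \<open>c\<close> one
  can therefore remove a triple from every surviving set with \<open>2 \<le> s \<le> 6\<close> and \<open>3v \<le> 4s + 5\<close> and still
  keep a constant proportion (\<open>deletion_method\<close>, \<open>sum_dense_configs_weight_le\<close>).

  What is left is \<open>sparse\<close>: any 2, 3, 4, 5, 6 of its triples span at least 5, 6, 8, 9, 10 points.
  This forces 3-union-freeness (\<open>sparse_imp_union_free_3\<close>): if \<open>A \<noteq> B\<close> have the same union, then
  \<open>A \<union> B\<close> is a set of at most 6 triples that lies within the at most 9 points covered by \<open>A\<close>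
  alone, and in each case it or a subset of it spans too few points. The exponent cannot be improved
  by the same count: 4 triples on 7 points must be excluded, and there \<open>3v = 4s + 5\<close>.
\<close>

section \<open>Sparse triple systems are 3-union-free\<close>

text \<open>
  The bound \<open>3v > 4s + 5\<close> is the complement of the range of \<open>(s, v)\<close> that the deletion method can
  afford at density \<open>n\<^sup>-\<^sup>4\<^sup>/\<^sup>3\<close>; two families of at most three triples involve at most six.
\<close>

definition sparse :: "'a set set \<Rightarrow> bool" where
  "sparse F \<longleftrightarrow> (\<forall>C\<subseteq>F. 2 \<le> card C \<and> card C \<le> 6 \<longrightarrow> 4 * card C + 5 < 3 * card (\<Union>C))"

lemma sparse_card_Union:
  assumes "sparse F" "C \<subseteq> F" "2 \<le> card C" "card C \<le> 6"
  shows "4 * card C + 5 < 3 * card (\<Union>C)"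
  using assms by (auto simp: sparse_def)

lemma sparse_card_Int_le:
  assumes F: "sparse F" "\<And>e. e \<in> F \<Longrightarrow> card e = 3" and "x \<in> F" "y \<in> F" "x \<noteq> y"
  shows "card (x \<inter> y) \<le> 1"
proof -
  have "finite x" "finite y" using assms by (auto intro: card_ge_0_finite)
  then have "card (x \<union> y) + card (x \<inter> y) = 6"
    using card_Un_Int[of x y] F(2) assms by simp
  moreover have "4 * card {x, y} + 5 < 3 * card (\<Union>{x, y})"
    using assms by (intro sparse_card_Union[OF F(1)]) auto
  ultimately show ?thesis using \<open>x \<noteq> y\<close> by simp
qed

text \<open>
  By pigeonhole, a triple inside the union of two others would share two points with one of them.
\<close>

lemma sparse_not_subset_Un:
  assumes F: "sparse F" "\<And>e. e \<in> F \<Longrightarrow> card e = 3"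
    and "x \<in> F" "y \<in> F" "z \<in> F" "x \<noteq> y" "x \<noteq> z"
  shows "\<not> x \<subseteq> y \<union> z"
proof
  assume "x \<subseteq> y \<union> z"
  then have "x = (x \<inter> y) \<union> (x \<inter> z)" by auto
  then have "card x \<le> card (x \<inter> y) + card (x \<inter> z)" by (metis card_Un_le)
  moreover have "card (x \<inter> y) \<le> 1" "card (x \<inter> z) \<le> 1"
    using sparse_card_Int_le[OF F] assms by blast+
  ultimately show False using F(2)[OF \<open>x \<in> F\<close>] by simp
qed

lemma card_Union_triples_le:
  assumes "\<And>e. e \<in> C \<Longrightarrow> card e = 3"
  shows "card (\<Union>C) \<le> 3 * card C"
proof -
  have "sum card C = (\<Sum>e\<in>C. 3)" using assms by (intro sum.cong) auto
  then show ?thesis using card_Union_le_sum_card[of C] by simp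
qed

lemma sparse_Union_eq_card_le_2:
  assumes F: "sparse F" "\<And>e. e \<in> F \<Longrightarrow> card e = 3"
    and AB: "A \<subseteq> F" "B \<subseteq> F" "\<Union>A = \<Union>B" "finite A" "finite B"
    and card: "card A \<le> 3" "0 < card B" "card B \<le> 2"
  shows "A \<subseteq> B"
proof
  fix x assume x: "x \<in> A"
  show "x \<in> B"
  proof (rule ccontr)
    assume nB: "x \<notin> B"
    have "\<exists>y z. B = {y, z}"
    proof (cases "card B = 1")
      case True then show ?thesis by (metis card_1_singletonE insert_absorb2)
    next
      case False then have "card B = 2" using card by linarith
      then show ?thesis by (auto simp: card_2_iff)
    qed
    then obtain y z where B: "B = {y, z}" by blast
    have "x \<subseteq> \<Union>A" using x by auto
    then have "x \<subseteq> y \<union> z" using AB(3) B by simp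
    moreover have "\<not> x \<subseteq> y \<union> z"
      using x nB B AB by (intro sparse_not_subset_Un[OF F]) auto
    ultimately show False by simp
  qed
qed

text \<open>
  Two distinct families of three triples share at most two members, and \<open>A \<union> B\<close> spans at most 9
  points. Sharing none is impossible, since six triples span at least 10. Sharing one member makes
  the five triples span exactly 9 points, so both families are disjoint triples and the four unshared
  triples live on the 6 points off the common one. Sharing two members leaves at least \<open>8 - 6\<close> points
  off these two; both unshared triples must contain them, but distinct triples share at most one.
\<close>

lemma sparse_Union_eq_card_3:
  assumes F: "sparse F" "\<And>e. e \<in> F \<Longrightarrow> card e = 3"
    and AB: "A \<subseteq> F" "B \<subseteq> F" "\<Union>A = \<Union>B" "card A = 3" "card B = 3"
  shows "A = B"
proof (rule ccontr)
  assume "A \<noteq> B"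
  have fin: "finite A" "finite B" using AB by (auto intro: card_ge_0_finite)
  have fine: "finite e" if "e \<in> A \<union> B" for e
  proof -
    have "card e = 3" using F(2) that AB by blast
    then show ?thesis by (auto intro: card_ge_0_finite)
  qed
  have fU: "finite (\<Union>A)" using fin fine by auto
  have un: "\<Union>(A \<union> B) = \<Union>A" using AB(3) by auto
  have s: "card (A \<union> B) + card (A \<inter> B) = 6"
    using card_Un_Int[OF fin] AB by simp
  have "A \<inter> B \<subset> A"
    using \<open>A \<noteq> B\<close> AB fin by (metis Int_lower1 card_subset_eq inf.absorb_iff1 psubsetI)
  then have "card (A \<inter> B) < 3" using psubset_card_mono[OF fin(1)] AB by metis
  moreover have big: "4 * card (A \<union> B) + 5 < 3 * card (\<Union>A)"
    using sparse_card_Union[OF F(1), of "A \<union> B"] s \<open>card (A \<inter> B) < 3\<close> AB un by simp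
  moreover have v: "card (\<Union>A) \<le> 9" using card_Union_triples_le[of A] F(2) AB by auto
  ultimately consider "card (A \<inter> B) = 1" | "card (A \<inter> B) = 2" using s by linarith
  then show False
  proof cases
    case 1
    then obtain g where g: "A \<inter> B = {g}" by (metis card_1_singletonE)
    have v9: "card (\<Union>A) \<ge> 9" using big s 1 by linarith
    \<comment> \<open>The other two triples of either family cover at most 6 of the 9 points, so it misses \<open>g\<close>.\<close>
    have disj: "g \<inter> \<Union>(X - {g}) = {}" if X: "X \<in> {A, B}" for X
    proof -
      have gX: "g \<in> X" "X \<subseteq> F" "finite X" "card X = 3" "\<Union>X = \<Union>A"
        using X g AB fin by auto
      have fg: "finite g" and fX: "finite (\<Union>(X - {g}))"
        using gX fine X fin by auto
      have "card (\<Union>(X - {g})) \<le> 3 * card (X - {g})"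
        by (rule card_Union_triples_le) (use F(2) gX in auto)
      then have "card (\<Union>(X - {g})) \<le> 6" using gX by simp
      moreover have "card g = 3" using F(2) gX by auto
      moreover have "g \<union> \<Union>(X - {g}) = \<Union>A" using gX by auto
      ultimately have "card (g \<inter> \<Union>(X - {g})) = 0"
        using card_Un_Int[OF fg fX] v9 by simp
      then show ?thesis using fg by simp
    qed
    define D where "D = A \<union> B - {g}"
    have "g \<inter> \<Union>D = {}" using disj[of A] disj[of B] by (auto simp: D_def)
    moreover have "\<Union>D \<subseteq> \<Union>A" using AB(3) by (auto simp: D_def)
    ultimately have "\<Union>D \<subseteq> \<Union>A - g" by auto
    then have "card (\<Union>D) \<le> card (\<Union>A - g)" using fU by (auto intro!: card_mono)
    also have "\<dots> = card (\<Union>A) - card g" using g by (intro card_Diff_subset fine) auto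
    also have "\<dots> \<le> 6" using v F(2)[of g] g AB by auto
    finally have "card (\<Union>D) \<le> 6" .
    moreover have "card D = 4"
    proof -
      have "g \<in> A \<union> B" "finite (A \<union> B)" using g fin by auto
      then show ?thesis using s 1 unfolding D_def by (simp add: card_Diff_singleton)
    qed
    ultimately show False
      using sparse_card_Union[OF F(1), of D] AB by (auto simp: D_def)
  next
    case 2
    have v8: "card (\<Union>A) \<ge> 8" using big s 2 by linarith
    have "card (A - B) = 1" "card (B - A) = 1"
      using 2 AB fin card_Diff_subset_Int[of A B] card_Diff_subset_Int[of B A]
      by (auto simp: Int_commute)
    then obtain x y where xy: "A - B = {x}" "B - A = {y}" by (metis card_1_singletonE)
    have "card (\<Union>(A \<inter> B)) \<le> 3 * card (A \<inter> B)"
      by (rule card_Union_triples_le) (use F(2) AB in auto)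
    then have c6: "card (\<Union>(A \<inter> B)) \<le> 6" using 2 by simp
    have eqA: "\<Union>A = x \<union> \<Union>(A \<inter> B)" using xy by auto
    have eqB: "\<Union>A = y \<union> \<Union>(A \<inter> B)" unfolding AB(3) using xy by auto
    have "x \<in> A" using xy by auto
    then have fxy: "finite (x \<inter> y)" using fine by auto
    have "\<Union>A \<subseteq> (x \<inter> y) \<union> \<Union>(A \<inter> B)" using eqA eqB by auto
    then have "card (\<Union>A) \<le> card ((x \<inter> y) \<union> \<Union>(A \<inter> B))"
      using fxy fin fine by (intro card_mono) auto
    also have "\<dots> \<le> card (x \<inter> y) + card (\<Union>(A \<inter> B))" by (rule card_Un_le)
    finally have "card (x \<inter> y) \<ge> 2" using v8 c6 by simp
    moreover have "card (x \<inter> y) \<le> 1"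
      using xy AB by (intro sparse_card_Int_le[OF F]) auto
    ultimately show False by simp
  qed
qed

lemma sparse_imp_union_free_3:
  assumes F: "sparse F" "\<And>e. e \<in> F \<Longrightarrow> card e = 3"
  shows "union_free 3 F"
  unfolding union_free_def
proof (intro allI impI notI, elim conjE)
  fix A B
  assume AB: "A \<subseteq> F" "B \<subseteq> F" "A \<noteq> B" "0 < card A" "card A \<le> 3" "0 < card B" "card B \<le> 3"
    and U: "\<Union>A = \<Union>B"
  have fin: "finite A" "finite B" using AB by (auto intro: card_ge_0_finite)
  have *: "X \<subseteq> Y"
    if "X \<subseteq> F" "Y \<subseteq> F" "\<Union>X = \<Union>Y" "finite X" "finite Y" "card X \<le> 3" "0 < card Y" "card Y \<le> 2"
    for X Y using sparse_Union_eq_card_le_2[OF F that] .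
  consider "card A = 3 \<and> card B = 3" | "card A \<le> 2" | "card B \<le> 2" using AB by linarith
  \<comment> \<open>If one family has at most two members, then it contains the other, which is thus small as well.\<close>
  then have "A = B"
  proof cases
    case 1 then show ?thesis using sparse_Union_eq_card_3[OF F] AB U by blast
  next
    case 2
    then have "B \<subseteq> A" using * AB U fin by metis
    moreover from this have "card B \<le> 2" using 2 card_mono[OF fin(1)] by (meson le_trans)
    then have "A \<subseteq> B" using * AB U fin by metis
    ultimately show ?thesis by simp
  next
    case 3
    then have "A \<subseteq> B" using * AB U fin by metis
    moreover from this have "card A \<le> 2" using 3 card_mono[OF fin(2)] by (meson le_trans)
    then have "B \<subseteq> A" using * AB U fin by metis
    ultimately show ?thesis by simp
  qed
  then show False using AB by simp
qed

section \<open>The deletion method\<close>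

text \<open>
  The left-hand side is the probability that a random subset of \<open>E\<close>, which keeps each element
  independently with probability \<open>p\<close>, contains \<open>C\<close>. It is the expansion of a product over \<open>E\<close> with
  factor \<open>p + 0\<close> on \<open>C\<close> and \<open>p + (1 - p)\<close> elsewhere.
\<close>

lemma sum_random_subset_weights:
  fixes p :: real
  assumes "finite E" "C \<subseteq> E"
  shows "(\<Sum>S\<in>Pow E. p ^ card S * (1 - p) ^ card (E - S) * of_bool (C \<subseteq> S)) = p ^ card C"
proof -
  have fC: "finite C" using assms finite_subset by blast
  define q where "q x = (if x \<in> C then 0 else 1 - p)" for x
  have "(\<Prod>x\<in>E. p + q x) = (\<Prod>x\<in>E. if x \<in> C then p else 1)"
    by (intro prod.cong) (auto simp: q_def)
  also have "\<dots> = p ^ card C"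
    using assms by (simp add: prod.If_cases Int_absorb1)
  finally have "p ^ card C = (\<Sum>S\<in>Pow E. (\<Prod>x\<in>S. p) * (\<Prod>x\<in>E - S. q x))"
    using prod_add[OF assms(1), of "\<lambda>_. p" q] by simp
  also have "\<dots> = (\<Sum>S\<in>Pow E. p ^ card S * (1 - p) ^ card (E - S) * of_bool (C \<subseteq> S))"
  proof (intro sum.cong refl)
    fix S assume S: "S \<in> Pow E"
    have "(\<Prod>x\<in>E - S. q x) = (1 - p) ^ card (E - S) * of_bool (C \<subseteq> S)"
    proof (cases "C \<subseteq> S")
      case True
      then have "(\<Prod>x\<in>E - S. q x) = (\<Prod>x\<in>E - S. 1 - p)"
        by (intro prod.cong) (auto simp: q_def)
      then show ?thesis using True by simp
    next
      case False
      then have "\<exists>x\<in>E - S. q x = 0" using assms by (auto simp: q_def)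
      then show ?thesis using False assms by (simp add: prod_zero_iff)
    qed
    then show "(\<Prod>x\<in>S. p) * (\<Prod>x\<in>E - S. q x) =
        p ^ card S * (1 - p) ^ card (E - S) * of_bool (C \<subseteq> S)" by simp
  qed
  finally show ?thesis by simp
qed

lemma weighted_average_attained:
  fixes w X :: "'b \<Rightarrow> real"
  assumes "finite I" "\<And>i. i \<in> I \<Longrightarrow> 0 \<le> w i" "sum w I = 1"
  shows "\<exists>i\<in>I. (\<Sum>i\<in>I. w i * X i) \<le> X i"
proof -
  have ne: "I \<noteq> {}" using assms(3) by auto
  define M where "M = Max (X ` I)"
  have "(\<Sum>i\<in>I. w i * X i) \<le> (\<Sum>i\<in>I. w i * M)"
    using assms by (intro sum_mono mult_left_mono) (auto simp: M_def)
  also have "\<dots> = M" using assms(3) by (simp flip: sum_distrib_right)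
  finally have "(\<Sum>i\<in>I. w i * X i) \<le> M" .
  moreover have "M \<in> X ` I" unfolding M_def using assms ne by (intro Max_in) auto
  ultimately show ?thesis by auto
qed

text \<open>
  Some subset \<open>S\<close> of \<open>E\<close> attains at least the expected number of elements minus the expected number of
  members of \<open>\<C>\<close> inside it. Removing one element from each of these members costs no more than
  their number and destroys them all.
\<close>

lemma deletion_method:
  fixes p :: real
  assumes E: "finite E" and p: "0 \<le> p" "p \<le> 1"
    and \<C>: "\<C> \<subseteq> Pow E" "{} \<notin> \<C>"
  shows "\<exists>F\<subseteq>E. (\<forall>C\<in>\<C>. \<not> C \<subseteq> F) \<and> p * card E - (\<Sum>C\<in>\<C>. p ^ card C) \<le> card F"
proof -
  define w where "w S = p ^ card S * (1 - p) ^ card (E - S)" for S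
  have fin\<C>: "finite \<C>" using E \<C> finite_subset by blast
  have W: "(\<Sum>S\<in>Pow E. w S * of_bool (C \<subseteq> S)) = p ^ card C" if "C \<subseteq> E" for C
    unfolding w_def by (rule sum_random_subset_weights[OF E that])
  have w1: "sum w (Pow E) = 1" using W[of "{}"] by simp
  define X where "X S = real (card S) - real (card {C\<in>\<C>. C \<subseteq> S})" for S
  have X: "X S = (\<Sum>e\<in>E. of_bool ({e} \<subseteq> S)) - (\<Sum>C\<in>\<C>. of_bool (C \<subseteq> S))"
    if "S \<in> Pow E" for S
  proof -
    have "E \<inter> {e. {e} \<subseteq> S} = S" using that by auto
    then show ?thesis using E fin\<C> unfolding X_def
      by (simp add: sum_of_bool_eq Int_def)
  qed
  have "(\<Sum>S\<in>Pow E. w S * X S) =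
      (\<Sum>S\<in>Pow E. \<Sum>e\<in>E. w S * of_bool ({e} \<subseteq> S)) - (\<Sum>S\<in>Pow E. \<Sum>C\<in>\<C>. w S * of_bool (C \<subseteq> S))"
    by (simp add: X right_diff_distrib sum_subtractf sum_distrib_left)
  also have "\<dots> = (\<Sum>e\<in>E. \<Sum>S\<in>Pow E. w S * of_bool ({e} \<subseteq> S)) - (\<Sum>C\<in>\<C>. \<Sum>S\<in>Pow E. w S * of_bool (C \<subseteq> S))"
    by (intro arg_cong2[where f = minus] sum.swap)
  also have "\<dots> = (\<Sum>e\<in>E. p ^ card {e}) - (\<Sum>C\<in>\<C>. p ^ card C)"
    using \<C> by (intro arg_cong2[where f = minus] sum.cong refl W) auto
  finally have EX: "(\<Sum>S\<in>Pow E. w S * X S) = p * card E - (\<Sum>C\<in>\<C>. p ^ card C)" by simp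
  obtain S where S: "S \<subseteq> E" "p * card E - (\<Sum>C\<in>\<C>. p ^ card C) \<le> X S"
    using weighted_average_attained[of "Pow E" w X] E p w1 unfolding EX by (auto simp: w_def)
  have fS: "finite S" using S E finite_subset by blast
  define pick where "pick C = (SOME e. e \<in> C)" for C :: "'a set"
  have pick: "pick C \<in> C" if "C \<in> \<C>" for C
    unfolding pick_def using that \<C>(2) by (metis ex_in_conv someI)
  define D where "D = pick ` {C\<in>\<C>. C \<subseteq> S}"
  have "finite D" "card D \<le> card {C\<in>\<C>. C \<subseteq> S}"
    using fin\<C> by (auto simp: D_def card_image_le)
  then have "X S \<le> card (S - D)"
    using diff_card_le_card_Diff[of D S] unfolding X_def by linarith
  moreover have "\<not> C \<subseteq> S - D" if "C \<in> \<C>" for C using that pick[OF that] by (auto simp: D_def)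
  ultimately show ?thesis using S by (intro exI[of _ "S - D"]) auto
qed

section \<open>Counting the dense configurations\<close>

text \<open>
  Expanding \<open>(1 + 1/n)\<^sup>n \<le> exp 1\<close> over subsets gives a summable weight \<open>n\<^sup>-\<^sup>v\<close> for the vertex sets
  of size \<open>v\<close>, which treats the configurations of all sizes at once.
\<close>

lemma sum_power_card_Pow_le_3:
  "(\<Sum>V\<in>Pow {1..n}. (1 / real n) ^ card V) \<le> 3"
proof (cases "n = 0")
  case False
  have "(\<Sum>V\<in>Pow {1..n}. (1 / real n) ^ card V) = (1 + 1 / real n) ^ n"
    using prod_add[of "{1..n}" "\<lambda>_. 1 / real n" "\<lambda>_. 1"] by (simp add: add.commute)
  also have "\<dots> \<le> exp (1 / real n) ^ n"
    by (intro power_mono exp_ge_add_one_self) auto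
  also have "\<dots> = exp 1" using False by (simp flip: exp_of_nat_mult)
  also have "\<dots> \<le> 3" by (rule exp_le)
  finally show ?thesis .
qed simp

definition dense_configs :: "nat \<Rightarrow> nat set set set" where
  "dense_configs n = {C. C \<subseteq> {e. e \<subseteq> {1..n} \<and> card e = 3} \<and> 2 \<le> card C \<and> card C \<le> 6 \<and>
     3 * card (\<Union>C) \<le> 4 * card C + 5}"

text \<open>
  The condition \<open>3v \<le> 4s + 5\<close> says precisely that \<open>n\<^sup>-\<^sup>4\<^sup>s\<^sup>/\<^sup>3\<close> is at most \<open>n\<^sup>5\<^sup>/\<^sup>3 n\<^sup>-\<^sup>v\<close> (for \<open>n > 1\<close>).
\<close>

lemma dense_config_weight_le:
  assumes C: "C \<in> dense_configs n" and n: "0 < n" and c: "0 < c" "c \<le> 1"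
  shows "(c * real n powr (-4/3)) ^ card C \<le> c\<^sup>2 * real n powr (5/3) * (1 / real n) ^ card (\<Union>C)"
proof -
  let ?s = "card C" and ?v = "card (\<Union>C)"
  have "2 \<le> ?s" and sv: "3 * ?v \<le> 4 * ?s + 5" using C by (auto simp: dense_configs_def)
  have "(real n powr (-4/3)) ^ ?s = real n powr (real ?s * (-4/3))"
    using n by (simp add: powr_powr powr_realpow[symmetric] mult.commute)
  also have "\<dots> \<le> real n powr (5/3 - real ?v)"
    using n sv by (intro powr_mono) auto
  also have "\<dots> = real n powr (5/3) * (1 / real n) ^ ?v"
    using n by (simp add: powr_diff powr_realpow power_one_over)
  finally have "(real n powr (-4/3)) ^ ?s \<le> real n powr (5/3) * (1 / real n) ^ ?v" .
  moreover have "c ^ ?s \<le> c\<^sup>2" using \<open>2 \<le> ?s\<close> c by (intro power_decreasing) auto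
  ultimately have "c ^ ?s * (real n powr (-4/3)) ^ ?s \<le> c\<^sup>2 * (real n powr (5/3) * (1 / real n) ^ ?v)"
    using c by (intro mult_mono) auto
  then show ?thesis by (simp add: power_mult_distrib mult.assoc)
qed

text \<open>
  Any bound independent of \<open>n\<close> would do. Here \<open>3v \<le> 4 * 6 + 5\<close> gives \<open>v \<le> 9\<close>, and a configuration is
  a set of subsets of \<open>V\<close>.
\<close>

lemma card_dense_configs_with_Union_le:
  "card {C \<in> dense_configs n. \<Union>C = V} \<le> 2 ^ 2 ^ 9"
proof (cases "{C \<in> dense_configs n. \<Union>C = V} = {}")
  case False
  then obtain C where "C \<in> dense_configs n" "\<Union>C = V" by auto
  then have V: "V \<subseteq> {1..n}" "3 * card V \<le> 4 * card C + 5" "card C \<le> 6"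
    by (auto simp: dense_configs_def)
  then have fV: "finite V" and cV: "card V \<le> 9" by (auto intro: finite_subset)
  have "card {C \<in> dense_configs n. \<Union>C = V} \<le> card (Pow (Pow V))"
    using fV by (intro card_mono) auto
  also have "\<dots> = 2 ^ 2 ^ card V" using fV by (simp add: card_Pow)
  also have "\<dots> \<le> 2 ^ 2 ^ 9" using cV by (intro power_increasing) auto
  finally show ?thesis .
next
  case True
  then show ?thesis by (simp only: card.empty le0)
qed

lemma sum_dense_configs_weight_le:
  fixes c :: real
  assumes n: "0 < n" and c: "0 < c" "c \<le> 1"
  shows "(\<Sum>C\<in>dense_configs n. (c * real n powr (-4/3)) ^ card C)
    \<le> 3 * 2 ^ 2 ^ 9 * c\<^sup>2 * real n powr (5/3)"
proof -
  let ?D = "dense_configs n" and ?M = "c\<^sup>2 * real n powr (5/3)"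
  have D: "finite ?D"
    by (rule finite_subset[of _ "Pow (Pow {1..n})"]) (auto simp: dense_configs_def)
  have "(\<Sum>C\<in>?D. (c * real n powr (-4/3)) ^ card C) \<le> (\<Sum>C\<in>?D. ?M * (1 / real n) ^ card (\<Union>C))"
    using assms by (intro sum_mono dense_config_weight_le)
  also have "\<dots> = (\<Sum>V\<in>Pow {1..n}. \<Sum>C\<in>{C\<in>?D. \<Union>C = V}. ?M * (1 / real n) ^ card (\<Union>C))"
    using D by (intro sum.group[symmetric]) (auto simp: dense_configs_def)
  also have "\<dots> = (\<Sum>V\<in>Pow {1..n}. real (card {C\<in>?D. \<Union>C = V}) * (?M * (1 / real n) ^ card V))"
    by (intro sum.cong) auto
  also have "\<dots> \<le> (\<Sum>V\<in>Pow {1..n}. 2 ^ 2 ^ 9 * (?M * (1 / real n) ^ card V))"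
  proof (intro sum_mono mult_right_mono)
    fix V show "real (card {C\<in>?D. \<Union>C = V}) \<le> 2 ^ 2 ^ 9"
      using card_dense_configs_with_Union_le[of n V]
      by (metis of_nat_le_iff of_nat_numeral of_nat_power)
  qed auto
  also have "\<dots> = 2 ^ 2 ^ 9 * ?M * (\<Sum>V\<in>Pow {1..n}. (1 / real n) ^ card V)"
    by (simp add: sum_distrib_left mult.assoc)
  also have "\<dots> \<le> 2 ^ 2 ^ 9 * ?M * 3"
    by (intro mult_left_mono sum_power_card_Pow_le_3) auto
  finally show ?thesis by (simp only: mult_ac)
qed

section \<open>The lower bound\<close>

text \<open>
  The term \<open>1/27\<close> comes from \<open>n choose 3 \<ge> (n/3)\<^sup>3\<close>, and the subtracted term is the cost of deletion.
\<close>

lemma U_3_3_ge: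
  fixes c :: real
  assumes n: "3 \<le> n" and c: "0 < c" "c \<le> 1"
  shows "c * (1 / 27 - 3 * 2 ^ 2 ^ 9 * c) * real n powr (5/3) \<le> real (U 3 n 3)"
proof -
  define E where "E = {e. e \<subseteq> {1..n} \<and> card e = 3}"
  define p where "p = c * real n powr (-4/3)"
  have fE: "finite E" by (rule finite_subset[of _ "Pow {1..n}"]) (auto simp: E_def)
  have "real n powr (-4/3) \<le> 1" using n powr_mono[of "-4/3" 0 "real n"] by simp
  then have p: "0 \<le> p" "p \<le> 1" using c by (auto simp: p_def mult_le_one)
  have "\<exists>F\<subseteq>E. (\<forall>C\<in>dense_configs n. \<not> C \<subseteq> F) \<and>
      p * card E - (\<Sum>C\<in>dense_configs n. p ^ card C) \<le> card F"
    using fE p by (rule deletion_method) (auto simp: E_def dense_configs_def)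
  then obtain F where F: "F \<subseteq> E" "\<And>C. C \<in> dense_configs n \<Longrightarrow> \<not> C \<subseteq> F"
    "p * card E - (\<Sum>C\<in>dense_configs n. p ^ card C) \<le> card F" by blast
  have "sparse F" unfolding sparse_def
  proof (intro allI impI, rule ccontr)
    fix C assume C: "C \<subseteq> F" "2 \<le> card C \<and> card C \<le> 6" "\<not> 4 * card C + 5 < 3 * card (\<Union>C)"
    then have "C \<in> dense_configs n" using F(1) by (auto simp: dense_configs_def E_def)
    then show False using F(2) C by blast
  qed
  then have "union_free 3 F" using F(1) by (intro sparse_imp_union_free_3) (auto simp: E_def)
  then have "F \<in> union_free_families 3 n 3"
    using F(1) by (auto simp: union_free_families_def E_def)
  then have U: "card F \<le> U 3 n 3" by (rule card_le_U)
  have "card E = n choose 3" unfolding E_def using n_subsets[of "{1..n}" 3] by simp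
  moreover have "(real n / real 3) ^ 3 \<le> real (n choose 3)"
    using binomial_ge_n_over_k_pow_k[of 3 n, where 'a = real] n by simp
  ultimately have "real n ^ 3 / 27 \<le> card E" by (simp add: power_divide)
  then have "p * (real n ^ 3 / 27) \<le> p * card E" using p by (intro mult_left_mono) auto
  moreover have "p * (real n ^ 3 / 27) = c / 27 * real n powr (5/3)"
  proof -
    have "real n powr (-4/3) * real n ^ 3 = real n powr (-4/3) * real n powr 3"
      using n by simp
    also have "\<dots> = real n powr (-4/3 + 3)" by (simp only: powr_add)
    finally have "real n powr (-4/3) * real n ^ 3 = real n powr (-4/3 + 3)" .
    then show ?thesis by (simp add: p_def)
  qed
  moreover have "(\<Sum>C\<in>dense_configs n. p ^ card C) \<le> 3 * 2 ^ 2 ^ 9 * c\<^sup>2 * real n powr (5/3)"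
    unfolding p_def using n c by (intro sum_dense_configs_weight_le) auto
  ultimately have "c / 27 * real n powr (5/3) - 3 * 2 ^ 2 ^ 9 * c\<^sup>2 * real n powr (5/3) \<le> card F"
    using F(3) by linarith
  also have "\<dots> \<le> real (U 3 n 3)" using U by simp
  finally show ?thesis by (simp add: algebra_simps power2_eq_square)
qed

theorem proposition1p10:
  shows "\<exists>c::real. c > 0 \<and> (\<exists>N::nat. \<forall>n\<ge>N. real (U 3 n 3) \<ge> c * real n powr (5 / 3))"
proof -
  \<comment> \<open>With this choice, the deletions cost exactly half of the main term.\<close>
  define c :: real where "c = 1 / (162 * 2 ^ 2 ^ 9)"
  have c: "0 < c" "c \<le> 1" "c * (1 / 27 - 3 * 2 ^ 2 ^ 9 * c) = c / 54"
    by (simp_all add: c_def)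
  have "c / 54 * real n powr (5/3) \<le> real (U 3 n 3)" if "3 \<le> n" for n
    using U_3_3_ge[OF that c(1,2)] by (simp only: c(3))
  then show ?thesis using c(1) by (intro exI[of _ "c / 54"]) auto
qed

end
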